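(* For every infinite cardinal $\kappa$ and each positive integer $k$, $\mathrm{SDHL}(1,k,\kappa)$ holds.
   Context: A tree $T\subseteq {}^{<\kappa}\kappa$ is a set of sequences closed under initial segments, ordered by end-extension $\sqsubseteq$; $T(\zeta):=T\cap{}^{\zeta}\kappa$ is its $\zeta$-th level. $T$ is a $\kappa$-tree if $|T|=\kappa$ and every level of $T$ has cardinality less than $\kappa$. $T$ is perfect if every node of $T$ has an extension in $T$ which splits in $T$. $T\subseteq{}^{<\kappa}\kappa$ is regular if it is a perfect $\kappa$-tree in which every maximal branch has cofinality $\kappa$. $\mathrm{Cone}(t):=\{s\in{}^{<\kappa}\kappa:s\sqsupseteq t\}$. $X\subseteq{}^{<\kappa}\kappa$ dominates $Y\subseteq{}^{<\kappa}\kappa$ if $(\forall y\in Y)(\exists x\in X)\ y\sqsubseteq x$. Level-product: for an ordinal $\delta>0$ and $X_i\subseteq{}^{<\kappa}\kappa$ ($i<\delta$), with $X_i(\zeta):=X_i\cap{}^{\zeta}\kappa$, $\bigotimes_{i<\delta}X_i:=\{\langle x_i:i<\delta\rangle:(\exists\zeta<\kappa)(\forall i<\delta)\ x_i\in X_i(\zeta)\}$. $\mathrm{SDHL}(\delta,\sigma,\kappa)$ (for nonzero ordinals $\delta,\sigma$ and an infinite cardinal $\kappa$) is the statement: given any sequence $\langle T_i\subseteq{}^{<\kappa}\kappa:i<\delta\rangle$ of regular trees and any coloring $c:\bigotimes_{i<\delta}T_i\to\sigma$, there exist $\zeta<\zeta'<\kappa$, $\langle t_i\in T_i(\zeta):i<\delta\rangle$,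 and $\langle X_i\subseteq T_i(\zeta'):i<\delta\rangle$ such that each $X_i$ dominates $T_i(\zeta+1)\cap\mathrm{Cone}(t_i)$ and $|c[\bigotimes_{i<\delta}X_i]|=1$. (For $\delta=1$ this concerns a single regular tree $T$ and a coloring $c:T\to\sigma$.) *)

theory Defs
  imports Complex_Main "HOL-Library.FuncSet"
begin

unbundle cardinal_syntax

text \<open>
  An infinite cardinal \<open>\<kappa>\<close> is a cardinal order in the sense of the library (\<open>Cinfinite \<kappa>\<close>).  The
  ordinals below \<open>\<kappa>\<close> are the elements of \<open>Field \<kappa>\<close>: the element \<open>\<zeta>\<close> stands for the order type of
  \<open>underS \<kappa> \<zeta>\<close>.  A sequence of length \<open>\<zeta>\<close> is a partial function with domain \<open>underS \<kappa> \<zeta>\<close>.  The domains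
  of such sequences are initial segments of \<open>\<kappa>\<close>, so end-extension is the library relation
  \<open>\<subseteq>\<^sub>m\<close> on partial functions.
\<close>

definition seqs_of_length :: "'a rel \<Rightarrow> 'a \<Rightarrow> ('a \<rightharpoonup> 'a) set" where
  "seqs_of_length \<kappa> \<zeta> = {s. dom s = underS \<kappa> \<zeta> \<and> ran s \<subseteq> Field \<kappa>}"

definition seqs :: "'a rel \<Rightarrow> ('a \<rightharpoonup> 'a) set" where
  "seqs \<kappa> = (\<Union>\<zeta>\<in>Field \<kappa>. seqs_of_length \<kappa> \<zeta>)"

definition level :: "'a rel \<Rightarrow> ('a \<rightharpoonup> 'a) set \<Rightarrow> 'a \<Rightarrow> ('a \<rightharpoonup> 'a) set" where
  "level \<kappa> X \<zeta> = X \<inter> seqs_of_length \<kappa> \<zeta>"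

text \<open>The ordinal \<open>\<zeta> + 1\<close>; it lies below \<open>\<kappa>\<close> because an infinite cardinal is a limit ordinal.\<close>
definition ord_succ :: "'a rel \<Rightarrow> 'a \<Rightarrow> 'a" where
  "ord_succ \<kappa> \<zeta> = wo_rel.suc \<kappa> {\<zeta>}"

definition Cone :: "'a rel \<Rightarrow> ('a \<rightharpoonup> 'a) \<Rightarrow> ('a \<rightharpoonup> 'a) set" where
  "Cone \<kappa> t = {s \<in> seqs \<kappa>. t \<subseteq>\<^sub>m s}"

definition dominates :: "('a \<rightharpoonup> 'a) set \<Rightarrow> ('a \<rightharpoonup> 'a) set \<Rightarrow> bool" where
  "dominates X Y \<longleftrightarrow> (\<forall>y\<in>Y. \<exists>x\<in>X. y \<subseteq>\<^sub>m x)"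

definition tree :: "'a rel \<Rightarrow> ('a \<rightharpoonup> 'a) set \<Rightarrow> bool" where
  "tree \<kappa> T \<longleftrightarrow> T \<subseteq> seqs \<kappa> \<and> (\<forall>t\<in>T. \<forall>s\<in>seqs \<kappa>. s \<subseteq>\<^sub>m t \<longrightarrow> s \<in> T)"

definition kappa_tree :: "'a rel \<Rightarrow> ('a \<rightharpoonup> 'a) set \<Rightarrow> bool" where
  "kappa_tree \<kappa> T \<longleftrightarrow> tree \<kappa> T \<and> |T| =o \<kappa> \<and> (\<forall>\<zeta>\<in>Field \<kappa>. |level \<kappa> T \<zeta>| <o \<kappa>)"

text \<open>A node splits if it has at least two immediate successors.\<close>
definition splits_in :: "'a rel \<Rightarrow> ('a \<rightharpoonup> 'a) set \<Rightarrow> ('a \<rightharpoonup> 'a) \<Rightarrow> bool" where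
  "splits_in \<kappa> T t \<longleftrightarrow>
    (\<exists>\<zeta>\<in>Field \<kappa>. t \<in> level \<kappa> T \<zeta> \<and>
      (\<exists>x \<in> level \<kappa> T (ord_succ \<kappa> \<zeta>) \<inter> Cone \<kappa> t.
       \<exists>y \<in> level \<kappa> T (ord_succ \<kappa> \<zeta>) \<inter> Cone \<kappa> t. x \<noteq> y))"

definition perfect_tree :: "'a rel \<Rightarrow> ('a \<rightharpoonup> 'a) set \<Rightarrow> bool" where
  "perfect_tree \<kappa> T \<longleftrightarrow> tree \<kappa> T \<and> (\<forall>t\<in>T. \<exists>s\<in>T. t \<subseteq>\<^sub>m s \<and> splits_in \<kappa> T s)"

text \<open>\<open>pred_on.maxchain\<close> passes to the reflexive closure of its relation, so the reflexive \<open>\<subseteq>\<^sub>m\<close> may be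
  supplied directly.\<close>
definition maximal_branch :: "('a \<rightharpoonup> 'a) set \<Rightarrow> ('a \<rightharpoonup> 'a) set \<Rightarrow> bool" where
  "maximal_branch T B \<longleftrightarrow> pred_on.maxchain T (\<subseteq>\<^sub>m) B"

text \<open>\<open>\<kappa>\<close> is the least cardinality of a cofinal subset of the chain \<open>B\<close>.\<close>
definition has_cofinality :: "'a rel \<Rightarrow> ('a \<rightharpoonup> 'a) set \<Rightarrow> bool" where
  "has_cofinality \<kappa> B \<longleftrightarrow>
    (\<exists>C\<subseteq>B. dominates C B \<and> |C| =o \<kappa>) \<and> (\<forall>C\<subseteq>B. dominates C B \<longrightarrow> \<kappa> \<le>o |C| )"

definition regular_tree :: "'a rel \<Rightarrow> ('a \<rightharpoonup> 'a) set \<Rightarrow> bool" where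
  "regular_tree \<kappa> T \<longleftrightarrow>
    kappa_tree \<kappa> T \<and> perfect_tree \<kappa> T \<and> (\<forall>B. maximal_branch T B \<longrightarrow> has_cofinality \<kappa> B)"

text \<open>
  The ordinals \<open>\<delta>\<close> and \<open>\<sigma>\<close> are well-orders.  The ordinals below them are the elements of their fields,
  and a \<open>\<delta>\<close>-sequence is an extensional function on \<open>Field \<delta>\<close>.
\<close>

definition level_product ::
    "'a rel \<Rightarrow> 'd rel \<Rightarrow> ('d \<Rightarrow> ('a \<rightharpoonup> 'a) set) \<Rightarrow> ('d \<Rightarrow> ('a \<rightharpoonup> 'a)) set" where
  "level_product \<kappa> \<delta> X = (\<Union>\<zeta>\<in>Field \<kappa>. \<Pi>\<^sub>E i\<in>Field \<delta>. level \<kappa> (X i) \<zeta>)"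

definition SDHL :: "'d rel \<Rightarrow> 's rel \<Rightarrow> 'a rel \<Rightarrow> bool" where
  "SDHL \<delta> \<sigma> \<kappa> \<longleftrightarrow>
    (\<forall>T c. (\<forall>i\<in>Field \<delta>. regular_tree \<kappa> (T i)) \<and> c \<in> level_product \<kappa> \<delta> T \<rightarrow> Field \<sigma> \<longrightarrow>
      (\<exists>\<zeta>'\<in>Field \<kappa>. \<exists>\<zeta>\<in>underS \<kappa> \<zeta>'. \<exists>t X.
        (\<forall>i\<in>Field \<delta>.
          t i \<in> level \<kappa> (T i) \<zeta> \<and>
          X i \<subseteq> level \<kappa> (T i) \<zeta>' \<and>
          dominates (X i) (level \<kappa> (T i) (ord_succ \<kappa> \<zeta>) \<inter> Cone \<kappa> (t i))) \<and>
        card (c ` level_product \<kappa> \<delta> X) = 1))"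

end

theory Submission
  imports Defs
begin

text \<open>
  Suppose no node is a witness for any colour.  Starting from any node, successively replace the
  current node by one of its immediate successors so that, for one more colour, no extension of the
  new node has that colour on an unbounded set of levels.  At each step, every level in the current
  unbounded set provides such a successor, and since there are fewer than \<open>\<kappa>\<close> immediate successors
  and a regular tree forces \<open>\<kappa>\<close> to be regular, one successor works for unboundedly many of these
  levels.  After all finitely many colours are excluded, the last node has no extension
  on unboundedly many levels, but every node of a regular tree extends to every higher level.
\<close>

section \<open>Chains and maximal branches of partial functions\<close>

lemma chain_map_le_iff:
  fixes T B :: "('a \<rightharpoonup> 'b) set"
  shows
  "pred_on.chain T (\<subseteq>\<^sub>m) B \<longleftrightarrow> B \<subseteq> T \<and> (\<forall>x\<in>B. \<forall>y\<in>B. x \<subseteq>\<^sub>m y \<or> y \<subseteq>\<^sub>m x)"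
proof -
  have "(\<subseteq>\<^sub>m)\<^sup>=\<^sup>= x y \<longleftrightarrow> x \<subseteq>\<^sub>m y" for x y :: "'a \<rightharpoonup> 'b" by auto
  then show ?thesis by (simp only: pred_on.chain_def)
qed

lemma maximal_branch_iff:
  "maximal_branch T B \<longleftrightarrow> pred_on.chain T (\<subseteq>\<^sub>m) B \<and> (\<forall>S. pred_on.chain T (\<subseteq>\<^sub>m) S \<longrightarrow> \<not> B \<subset> S)"
  unfolding maximal_branch_def pred_on.maxchain_def by blast

lemma maximal_branch_subset: "maximal_branch T B \<Longrightarrow> B \<subseteq> T"
  by (simp add: maximal_branch_iff chain_map_le_iff)

lemma maximal_branch_linear:
  "maximal_branch T B \<Longrightarrow> x \<in> B \<Longrightarrow> y \<in> B \<Longrightarrow> x \<subseteq>\<^sub>m y \<or> y \<subseteq>\<^sub>m x"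
  by (simp add: maximal_branch_iff chain_map_le_iff)

text \<open>The Hausdorff principle is applied inside the set \<open>A\<close> of nodes comparable
  with \<open>t\<close>. A maximal chain there must contain \<open>t\<close>, and any chain of
  \<open>T\<close> containing it then consists of nodes comparable with \<open>t\<close>, so
  maximality in \<open>A\<close> gives maximality in \<open>T\<close>.\<close>

lemma exists_maximal_branch_through:
  assumes "t \<in> T"
  obtains B where "maximal_branch T B" "t \<in> B"
proof -
  define A where "A = {x \<in> T. x \<subseteq>\<^sub>m t \<or> t \<subseteq>\<^sub>m x}"
  obtain B where B: "maximal_branch A B"
    unfolding maximal_branch_def using pred_on.Hausdorff by blast
  then have chB: "pred_on.chain A (\<subseteq>\<^sub>m) B"
    and maxB: "\<And>S. pred_on.chain A (\<subseteq>\<^sub>m) S \<Longrightarrow> \<not> B \<subset> S"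
    by (simp_all add: maximal_branch_iff)
  have "pred_on.chain A (\<subseteq>\<^sub>m) (insert t B)"
    using chB assms by (auto simp: chain_map_le_iff A_def)
  then have tB: "t \<in> B" using maxB by blast
  have "maximal_branch T B"
    unfolding maximal_branch_iff
  proof (intro conjI allI impI)
    show "pred_on.chain T (\<subseteq>\<^sub>m) B"
      using chB by (auto simp: chain_map_le_iff A_def)
    fix S assume S: "pred_on.chain T (\<subseteq>\<^sub>m) S"
    show "\<not> B \<subset> S"
    proof
      assume "B \<subset> S"
      then have "t \<in> S" using tB by blast
      then have "S \<subseteq> A" using S by (auto simp: chain_map_le_iff A_def)
      then have "pred_on.chain A (\<subseteq>\<^sub>m) S" using S by (simp add: chain_map_le_iff)
      then show False using maxB \<open>B \<subset> S\<close> by blast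
    qed
  qed
  then show thesis using tB by (rule that)
qed

text \<open>No inclusion of \<open>A\<close> in \<open>Field \<kappa>\<close> is demanded:
  \<open>underS \<kappa> a\<close> is empty for \<open>a\<close> outside the field, so such an
  element never serves as a witness.\<close>

definition unbounded_in :: "'a rel \<Rightarrow> 'a set \<Rightarrow> bool" where
  "unbounded_in \<kappa> A \<longleftrightarrow> (\<forall>\<zeta>\<in>Field \<kappa>. \<exists>a\<in>A. \<zeta> \<in> underS \<kappa> a)"

section \<open>Levels met by branches of a regular tree\<close>

context
  fixes \<kappa> :: "'a rel"
  assumes inf: "Cinfinite \<kappa>"
begin

lemma wo_rel_kappa: "wo_rel \<kappa>"
  using inf by (simp add: card_order_on_well_order_on wo_rel_def)

lemma ord_succ_in_Field:
  assumes "\<zeta> \<in> Field \<kappa>"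
  shows "ord_succ \<kappa> \<zeta> \<in> Field \<kappa>" "(\<zeta>, ord_succ \<kappa> \<zeta>) \<in> \<kappa>"
proof -
  \<comment> \<open>An infinite cardinal is a limit, so \<open>\<zeta>\<close> has a strict upper
    bound; the facts about \<open>wo_rel.suc\<close> require one.\<close>
  obtain b where "b \<in> Field \<kappa>" "\<zeta> \<noteq> b" "(\<zeta>, b) \<in> \<kappa>"
    using infinite_Card_order_limit[of \<kappa> \<zeta>] inf assms by (auto simp: cinfinite_def)
  then have ne: "AboveS \<kappa> {\<zeta>} \<noteq> {}" by (auto simp: AboveS_def)
  have sub: "{\<zeta>} \<subseteq> Field \<kappa>" using assms by simp
  show "ord_succ \<kappa> \<zeta> \<in> Field \<kappa>"
    unfolding ord_succ_def by (rule wo_rel.suc_inField[OF wo_rel_kappa sub ne])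
  show "(\<zeta>, ord_succ \<kappa> \<zeta>) \<in> \<kappa>"
    unfolding ord_succ_def using wo_rel.suc_greater[OF wo_rel_kappa sub ne] by simp
qed

lemma underS_mono: "(a, b) \<in> \<kappa> \<Longrightarrow> underS \<kappa> a \<subseteq> underS \<kappa> b"
  using underS_incr wo_rel.TRANS[OF wo_rel_kappa] wo_rel.ANTISYM[OF wo_rel_kappa] by metis

text \<open>If the two nodes were ordered the other way, comparing domains would force them to be
  equal. In particular, a branch has at most one node on each level.\<close>

lemma maximal_branch_le:
  assumes "maximal_branch T B" "x \<in> B" "y \<in> B"
    and "x \<in> level \<kappa> T a" "y \<in> level \<kappa> T b" "(a, b) \<in> \<kappa>"
  shows "x \<subseteq>\<^sub>m y"
proof -
  have "x \<subseteq>\<^sub>m y \<or> y \<subseteq>\<^sub>m x"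
    using assms(1-3) by (rule maximal_branch_linear)
  moreover have "x \<subseteq>\<^sub>m y" if "y \<subseteq>\<^sub>m x"
  proof -
    have "dom x \<subseteq> dom y"
      using assms(4-6) underS_mono by (auto simp: level_def seqs_of_length_def)
    moreover have "dom y \<subseteq> dom x" using that by (rule map_le_implies_dom_le)
    ultimately show ?thesis using that by (simp add: map_le_def)
  qed
  ultimately show ?thesis by blast
qed

lemma in_tree_level:
  assumes "tree \<kappa> T" "x \<in> T"
  obtains a where "a \<in> Field \<kappa>" "x \<in> level \<kappa> T a"
  using assms unfolding tree_def seqs_def level_def by blast

lemma not_in_underS:
  "a \<in> Field \<kappa> \<Longrightarrow> b \<in> Field \<kappa> \<Longrightarrow> a \<notin> underS \<kappa> b \<Longrightarrow> (b, a) \<in> \<kappa>"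
  using wo_rel.TOTALS[OF wo_rel_kappa] by (auto simp: underS_def)

text \<open>A branch staying below level \<open>\<zeta>\<close> injects into
  \<open>underS \<kappa> \<zeta>\<close>, so it has fewer than \<open>\<kappa>\<close> nodes. Being
  cofinal in itself, it would then violate \<open>has_cofinality\<close>.\<close>

lemma maximal_branch_unbounded:
  assumes T: "regular_tree \<kappa> T" and B: "maximal_branch T B" and \<zeta>: "\<zeta> \<in> Field \<kappa>"
  obtains a x where "x \<in> B" "x \<in> level \<kappa> T a" "(\<zeta>, a) \<in> \<kappa>"
proof (rule ccontr)
  assume "\<not> thesis"
  with that have bounded: "\<And>a x. x \<in> B \<Longrightarrow> x \<in> level \<kappa> T a \<Longrightarrow> (\<zeta>, a) \<notin> \<kappa>" by blast
  have tr: "tree \<kappa> T" and cof: "has_cofinality \<kappa> B"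
    using T B unfolding regular_tree_def kappa_tree_def by auto
  have BT: "B \<subseteq> T" using B by (rule maximal_branch_subset)
  have "\<exists>a. a \<in> underS \<kappa> \<zeta> \<and> x \<in> level \<kappa> T a" if x: "x \<in> B" for x
  proof -
    obtain a where a: "a \<in> Field \<kappa>" "x \<in> level \<kappa> T a"
      using in_tree_level[OF tr] BT x by blast
    with bounded x not_in_underS[OF a(1) \<zeta>] show ?thesis by blast
  qed
  then obtain l where l: "\<And>x. x \<in> B \<Longrightarrow> l x \<in> underS \<kappa> \<zeta> \<and> x \<in> level \<kappa> T (l x)"
    by metis
  have "inj_on l B"
  proof (rule inj_onI)
    fix x y assume xy: "x \<in> B" "y \<in> B" "l x = l y"
    then have "(l x, l y) \<in> \<kappa>" "(l y, l x) \<in> \<kappa>"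
      using l[of x] wo_rel.REFL[OF wo_rel_kappa]
      by (auto simp: underS_def refl_on_def Field_def)
    then show "x = y"
      using maximal_branch_le[OF B] xy l map_le_antisym by blast
  qed
  then have "|B| \<le>o |underS \<kappa> \<zeta>|"
    using l by (intro card_of_ordLeqI[of l]) auto
  moreover have "|underS \<kappa> \<zeta>| <o \<kappa>"
    using inf \<zeta> by (simp add: card_of_underS)
  moreover have "\<kappa> \<le>o |B|"
    using cof unfolding has_cofinality_def dominates_def by (meson map_le_refl order_refl)
  ultimately show False
    using not_ordLess_ordLeq ordLeq_ordLess_trans by blast
qed

text \<open>A maximal branch through \<open>t\<close> reaches level \<open>\<zeta>'\<close> or
  beyond. Cutting such a node down to length \<open>\<zeta>'\<close> stays in the tree and still
  extends \<open>t\<close>.\<close>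

lemma regular_tree_extension:
  assumes T: "regular_tree \<kappa> T" and t: "t \<in> level \<kappa> T \<zeta>" and \<zeta>': "(\<zeta>, \<zeta>') \<in> \<kappa>"
  obtains x where "x \<in> level \<kappa> T \<zeta>'" "t \<subseteq>\<^sub>m x"
proof -
  have tr: "tree \<kappa> T"
    using T unfolding regular_tree_def kappa_tree_def by auto
  have F: "\<zeta>' \<in> Field \<kappa>" using \<zeta>' by (simp add: FieldI2)
  have "t \<in> T" using t by (simp add: level_def)
  then obtain B where B: "maximal_branch T B" "t \<in> B"
    by (rule exists_maximal_branch_through)
  obtain a x where x: "x \<in> B" "x \<in> level \<kappa> T a" "(\<zeta>', a) \<in> \<kappa>"
    using maximal_branch_unbounded[OF T B(1) F] by blast
  let ?y = "x |` underS \<kappa> \<zeta>'"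
  have tx: "t \<subseteq>\<^sub>m x"
    using maximal_branch_le[OF B(1) B(2) x(1) t x(2)] \<zeta>' x(3)
      wo_rel.TRANS[OF wo_rel_kappa] by (meson transD)
  have "dom ?y = underS \<kappa> \<zeta>'"
    using x(2) underS_mono[OF x(3)] by (auto simp: level_def seqs_of_length_def)
  moreover have "ran ?y \<subseteq> Field \<kappa>"
    using x(2) by (auto simp: level_def seqs_of_length_def ran_def restrict_map_def split: if_splits)
  ultimately have "?y \<in> seqs_of_length \<kappa> \<zeta>'" by (simp add: seqs_of_length_def)
  moreover have "?y \<subseteq>\<^sub>m x" by (auto simp: map_le_def restrict_map_def dom_def)
  ultimately have "?y \<in> level \<kappa> T \<zeta>'"
    using tr F x(2) unfolding tree_def level_def seqs_def by blast
  moreover have "t \<subseteq>\<^sub>m ?y"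
    using tx t underS_mono[OF \<zeta>']
    by (auto simp: map_le_def restrict_map_def level_def seqs_of_length_def)
  ultimately show thesis by (rule that)
qed

section \<open>Pigeonhole on levels and exclusion of colours\<close>

lemma regular_tree_nonempty:
  assumes "regular_tree \<kappa> T"
  shows "T \<noteq> {}"
proof
  assume "T = {}"
  then have "|{} :: ('a \<rightharpoonup> 'a) set| =o \<kappa>"
    using assms unfolding regular_tree_def kappa_tree_def by simp
  then have "|{} :: ('a \<rightharpoonup> 'a) set| =o |Field \<kappa>|"
    using inf card_of_Field_ordIso ordIso_symmetric ordIso_transitive by blast
  then have "finite (Field \<kappa>)"
    using card_of_ordIso_finite by blast
  then show False using inf by (simp add: cinfinite_def)
qed

text \<open>Regularity of \<open>\<kappa>\<close> is read off from the tree. If every fibre of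
  \<open>f\<close> were bounded, say by \<open>b s\<close>, choosing a node of one maximal branch at
  or above each level \<open>b s\<close> would give a cofinal subset of the branch of size at most
  \<open>|S|\<close>.\<close>

lemma regular_tree_pigeonhole:
  assumes T: "regular_tree \<kappa> T" and A: "unbounded_in \<kappa> A"
    and f: "f \<in> A \<rightarrow> S" and S: "|S| <o \<kappa>"
  obtains s where "s \<in> S" "unbounded_in \<kappa> {a \<in> A. f a = s}"
proof (rule ccontr)
  assume "\<not> thesis"
  with that have "\<forall>s\<in>S. \<exists>b\<in>Field \<kappa>. \<forall>a\<in>A. f a = s \<longrightarrow> b \<notin> underS \<kappa> a"
    unfolding unbounded_in_def by blast
  then obtain b where b: "\<And>s. s \<in> S \<Longrightarrow> b s \<in> Field \<kappa>"
    "\<And>s a. s \<in> S \<Longrightarrow> a \<in> A \<Longrightarrow> f a = s \<Longrightarrow> b s \<notin> underS \<kappa> a"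
    by metis
  have tr: "tree \<kappa> T"
    using T unfolding regular_tree_def kappa_tree_def by auto
  obtain B where B: "maximal_branch T B"
    using regular_tree_nonempty[OF T] exists_maximal_branch_through by blast
  have BT: "B \<subseteq> T" using B by (rule maximal_branch_subset)
  have "\<exists>x. x \<in> B \<and> (\<exists>a. x \<in> level \<kappa> T a \<and> (b s, a) \<in> \<kappa>)" if "s \<in> S" for s
    using maximal_branch_unbounded[OF T B b(1)[OF that]] by blast
  then obtain x where x: "\<And>s. s \<in> S \<Longrightarrow> x s \<in> B"
    "\<And>s. s \<in> S \<Longrightarrow> \<exists>a. x s \<in> level \<kappa> T a \<and> (b s, a) \<in> \<kappa>"
    by metis
  have "dominates (x ` S) B"
    unfolding dominates_def
  proof
    fix y assume y: "y \<in> B"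
    then obtain e where e: "e \<in> Field \<kappa>" "y \<in> level \<kappa> T e"
      using in_tree_level[OF tr] BT by blast
    then obtain a where a: "a \<in> A" "e \<in> underS \<kappa> a"
      using A unfolding unbounded_in_def by blast
    then have fa: "f a \<in> S" using f by auto
    have "a \<in> Field \<kappa>" "(e, a) \<in> \<kappa>" using a(2) by (auto simp: underS_def FieldI2)
    \<comment> \<open>The level \<open>a\<close> lies in its own fibre, hence under that fibre's
      bound; so \<open>y\<close>, on a level \<open>e\<close> below \<open>a\<close>, lies under
      \<open>x (f a)\<close>.\<close>
    moreover have "(a, b (f a)) \<in> \<kappa>"
      using not_in_underS[OF b(1)[OF fa] \<open>a \<in> Field \<kappa>\<close>] b(2)[OF fa a(1) refl] by blast
    moreover obtain a' where "x (f a) \<in> level \<kappa> T a'" "(b (f a), a') \<in> \<kappa>"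
      using x(2)[OF fa] by blast
    ultimately have "y \<subseteq>\<^sub>m x (f a)"
      using maximal_branch_le[OF B y x(1)[OF fa] e(2)] wo_rel.TRANS[OF wo_rel_kappa]
      by (meson transD)
    then show "\<exists>x\<in>x ` S. y \<subseteq>\<^sub>m x" using fa by blast
  qed
  moreover have "x ` S \<subseteq> B" using x by blast
  ultimately have "\<kappa> \<le>o |x ` S|"
    using T B unfolding regular_tree_def has_cofinality_def by blast
  then have "\<kappa> \<le>o |S|" using card_of_image ordLeq_transitive by blast
  with S show False using not_ordLess_ordLeq by blast
qed

lemma regular_tree_homogeneous_successors:
  fixes c :: "('a \<rightharpoonup> 'a) \<Rightarrow> 'c"
  assumes T: "regular_tree \<kappa> T" and K: "finite K" and c: "c \<in> T \<rightarrow> K"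
  obtains \<zeta> \<zeta>' t i where "\<zeta> \<in> underS \<kappa> \<zeta>'" "t \<in> level \<kappa> T \<zeta>"
    "\<And>s. s \<in> level \<kappa> T (ord_succ \<kappa> \<zeta>) \<inter> Cone \<kappa> t \<Longrightarrow> \<exists>x\<in>level \<kappa> T \<zeta>'. s \<subseteq>\<^sub>m x \<and> c x = i"
proof (rule ccontr)
  assume "\<not> thesis"
  with that have bad: "\<exists>s\<in>level \<kappa> T (ord_succ \<kappa> \<zeta>) \<inter> Cone \<kappa> t.
      \<forall>x\<in>level \<kappa> T \<zeta>'. s \<subseteq>\<^sub>m x \<longrightarrow> c x \<noteq> i"
    if "\<zeta> \<in> underS \<kappa> \<zeta>'" "t \<in> level \<kappa> T \<zeta>" for \<zeta> \<zeta>' t i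
    using that by metis
  have tr: "tree \<kappa> T"
    using T unfolding regular_tree_def kappa_tree_def by auto
  \<comment> \<open>Induction on the set \<open>J\<close> of excluded colours. Both the node
    \<open>t\<close> and the set \<open>A\<close> of levels change at each step; unboundedness of
    \<open>A\<close> is what keeps the pigeonhole applicable.\<close>
  have "\<exists>\<zeta>\<in>Field \<kappa>. \<exists>t\<in>level \<kappa> T \<zeta>. \<exists>A. unbounded_in \<kappa> A \<and>
      (\<forall>a\<in>A. \<forall>x\<in>level \<kappa> T a. t \<subseteq>\<^sub>m x \<longrightarrow> c x \<notin> J)"
    if "finite J" for J
    using that
  proof (induction J)
    case empty
    obtain t \<zeta> where "\<zeta> \<in> Field \<kappa>" "t \<in> level \<kappa> T \<zeta>"
      using regular_tree_nonempty[OF T] in_tree_level[OF tr] by blast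
    moreover have "unbounded_in \<kappa> (Field \<kappa>)"
      using infinite_Card_order_limit[of \<kappa>] inf
      unfolding unbounded_in_def underS_def cinfinite_def by blast
    ultimately show ?case by blast
  next
    case (insert i J)
    then obtain \<zeta> t A where \<zeta>: "\<zeta> \<in> Field \<kappa>" and t: "t \<in> level \<kappa> T \<zeta>"
      and A: "unbounded_in \<kappa> A"
      and avoid: "\<And>a x. a \<in> A \<Longrightarrow> x \<in> level \<kappa> T a \<Longrightarrow> t \<subseteq>\<^sub>m x \<Longrightarrow> c x \<notin> J"
      by blast
    \<comment> \<open>The assumption \<open>bad\<close> speaks only of levels strictly above
      \<open>\<zeta>\<close>.\<close>
    define A' where "A' = {a \<in> A. \<zeta> \<in> underS \<kappa> a}"
    let ?S = "level \<kappa> T (ord_succ \<kappa> \<zeta>) \<inter> Cone \<kappa> t"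
    have "\<forall>a\<in>A'. \<exists>s\<in>?S. \<forall>x\<in>level \<kappa> T a. s \<subseteq>\<^sub>m x \<longrightarrow> c x \<noteq> i"
      using bad t unfolding A'_def by blast
    \<comment> \<open>The successor avoiding \<open>i\<close> depends on the level \<open>a\<close>;
      the pigeonhole below makes the choice constant on unboundedly many levels.\<close>
    then obtain f where f: "\<And>a. a \<in> A' \<Longrightarrow> f a \<in> ?S"
      "\<And>a x. a \<in> A' \<Longrightarrow> x \<in> level \<kappa> T a \<Longrightarrow> f a \<subseteq>\<^sub>m x \<Longrightarrow> c x \<noteq> i"
      by metis
    have "unbounded_in \<kappa> A'"
      unfolding unbounded_in_def
    proof
      fix \<eta> assume \<eta>: "\<eta> \<in> Field \<kappa>"
      define m where "m = wo_rel.max2 \<kappa> \<eta> \<zeta>"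
      have m: "(\<eta>, m) \<in> \<kappa>" "(\<zeta>, m) \<in> \<kappa>"
        using wo_rel.max2_greater[OF wo_rel_kappa \<eta> \<zeta>] unfolding m_def by auto
      then have "m \<in> Field \<kappa>" by (simp add: FieldI2)
      then obtain a where a: "a \<in> A" "m \<in> underS \<kappa> a"
        using A unfolding unbounded_in_def by blast
      then have "(m, a) \<in> \<kappa>" by (simp add: underS_def)
      then have "underS \<kappa> m \<subseteq> underS \<kappa> a" by (rule underS_mono)
      then have "\<eta> \<in> underS \<kappa> a" "\<zeta> \<in> underS \<kappa> a"
        using m a(2) by (auto simp: underS_def)
      then show "\<exists>a\<in>A'. \<eta> \<in> underS \<kappa> a" using a(1) unfolding A'_def by blast
    qed
    moreover have "f \<in> A' \<rightarrow> ?S" using f(1) by blast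
    moreover have "|?S| <o \<kappa>"
    proof -
      have "|level \<kappa> T (ord_succ \<kappa> \<zeta>)| <o \<kappa>"
        using T ord_succ_in_Field(1)[OF \<zeta>] unfolding regular_tree_def kappa_tree_def by blast
      then show ?thesis using card_of_mono1[OF Int_lower1] ordLeq_ordLess_trans by blast
    qed
    ultimately obtain s where s: "s \<in> ?S" "unbounded_in \<kappa> {a \<in> A'. f a = s}"
      by (rule regular_tree_pigeonhole[OF T])
    have "c x \<notin> insert i J"
      if "a \<in> {a \<in> A'. f a = s}" "x \<in> level \<kappa> T a" "s \<subseteq>\<^sub>m x" for a x
    proof -
      \<comment> \<open>Passing from \<open>t\<close> to its extension \<open>s\<close> preserves
        the earlier exclusions.\<close>
      have "t \<subseteq>\<^sub>m x" using s(1) that(3) map_le_trans unfolding Cone_def by blast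
      with that f(2)[of a x] avoid[of a x] show ?thesis unfolding A'_def by blast
    qed
    with s ord_succ_in_Field(1)[OF \<zeta>] show ?case by (meson IntD1)
  qed
  from this[OF K] obtain \<zeta> t A where \<zeta>: "\<zeta> \<in> Field \<kappa>" and t: "t \<in> level \<kappa> T \<zeta>"
    and A: "unbounded_in \<kappa> A"
    and avoid: "\<And>a x. a \<in> A \<Longrightarrow> x \<in> level \<kappa> T a \<Longrightarrow> t \<subseteq>\<^sub>m x \<Longrightarrow> c x \<notin> K"
    by blast
  obtain a where a: "a \<in> A" "(\<zeta>, a) \<in> \<kappa>"
    using A \<zeta> unfolding unbounded_in_def underS_def by blast
  obtain x where x: "x \<in> level \<kappa> T a" "t \<subseteq>\<^sub>m x"
    using regular_tree_extension[OF T t a(2)] by blast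
  with avoid[OF a(1)] c show False unfolding level_def by blast
qed

end

section \<open>Level products with one factor, and the theorem\<close>

lemma level_product_natLeq_on_1:
  assumes "X 0 \<subseteq> seqs \<kappa>"
  shows "level_product \<kappa> (natLeq_on 1) X = (\<lambda>x. \<lambda>i\<in>{0}. x) ` X 0"
proof -
  have F: "Field (natLeq_on 1) = {0}" by (subst Field_natLeq_on) auto
  have "(\<Pi>\<^sub>E i\<in>{0::nat}. level \<kappa> (X i) \<zeta>) = (\<lambda>x. \<lambda>i\<in>{0}. x) ` level \<kappa> (X 0) \<zeta>" for \<zeta>
  proof (intro equalityI subsetI)
    fix g assume g: "g \<in> (\<Pi>\<^sub>E i\<in>{0::nat}. level \<kappa> (X i) \<zeta>)"
    then have "g = (\<lambda>i\<in>{0}. g 0)" by (auto simp: fun_eq_iff PiE_def extensional_def)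
    with g show "g \<in> (\<lambda>x. \<lambda>i\<in>{0}. x) ` level \<kappa> (X 0) \<zeta>" by blast
  qed auto
  \<comment> \<open>The hypothesis enters here: each element of \<open>X 0\<close> is a sequence, so
    it lies on some level.\<close>
  moreover have "(\<Union>\<zeta>\<in>Field \<kappa>. level \<kappa> (X 0) \<zeta>) = X 0"
    using assms unfolding level_def seqs_def by blast
  ultimately show ?thesis by (simp only: level_product_def F image_UN[symmetric])
qed

theorem fact2p4:
  fixes \<kappa> :: "'a rel" and k :: nat
  assumes "Cinfinite \<kappa>" and "k > 0"
  shows "SDHL (natLeq_on 1) (natLeq_on k) \<kappa>"
  unfolding SDHL_def
proof (intro allI impI, elim conjE)
  fix T :: "nat \<Rightarrow> ('a \<rightharpoonup> 'a) set" and c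
  assume "\<forall>i\<in>Field (natLeq_on 1). regular_tree \<kappa> (T i)"
    and c: "c \<in> level_product \<kappa> (natLeq_on 1) T \<rightarrow> Field (natLeq_on k)"
  then have T: "regular_tree \<kappa> (T 0)" by (subst (asm) Field_natLeq_on) simp
  then have Tseqs: "T 0 \<subseteq> seqs \<kappa>"
    unfolding regular_tree_def kappa_tree_def tree_def by blast
  let ?e = "\<lambda>x. \<lambda>i\<in>{0::nat}. x"
  have fin: "finite (Field (natLeq_on k))" by (simp add: Field_natLeq_on)
  have "(\<lambda>x. c (?e x)) \<in> T 0 \<rightarrow> Field (natLeq_on k)"
    using c unfolding level_product_natLeq_on_1[of T, OF Tseqs] by blast
  from regular_tree_homogeneous_successors[OF assms(1) T fin this]
  obtain \<zeta> \<zeta>' t j where \<zeta>: "\<zeta> \<in> underS \<kappa> \<zeta>'" and t: "t \<in> level \<kappa> (T 0) \<zeta>"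
    and ext: "\<And>s. s \<in> level \<kappa> (T 0) (ord_succ \<kappa> \<zeta>) \<inter> Cone \<kappa> t
      \<Longrightarrow> \<exists>x\<in>level \<kappa> (T 0) \<zeta>'. s \<subseteq>\<^sub>m x \<and> c (?e x) = j"
    by metis
  have F: "\<zeta> \<in> Field \<kappa>" "\<zeta>' \<in> Field \<kappa>"
    using \<zeta> unfolding underS_def by (auto intro: FieldI1 FieldI2)
  \<comment> \<open>Taking every node of colour \<open>j\<close> on the level gives domination at
    once and allows no second colour.\<close>
  define X where "X = {x \<in> level \<kappa> (T 0) \<zeta>'. c (?e x) = j}"
  have dom: "dominates X (level \<kappa> (T 0) (ord_succ \<kappa> \<zeta>) \<inter> Cone \<kappa> t)"
    using ext unfolding dominates_def X_def by blast
  \<comment> \<open>Exactly one colour, rather than at most one, requires \<open>X\<close> to be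
    nonempty: \<open>t\<close> has an immediate successor, and domination puts an element of
    \<open>X\<close> above it.\<close>
  obtain s where s: "s \<in> level \<kappa> (T 0) (ord_succ \<kappa> \<zeta>)" "t \<subseteq>\<^sub>m s"
    using regular_tree_extension[OF assms(1) T t ord_succ_in_Field(2)[OF assms(1) F(1)]] by blast
  moreover have "s \<in> seqs \<kappa>" using s(1) Tseqs unfolding level_def by blast
  ultimately have "X \<noteq> {}"
    using dom unfolding dominates_def Cone_def by blast
  have "X \<subseteq> seqs \<kappa>" using Tseqs unfolding X_def level_def by blast
  then have "level_product \<kappa> (natLeq_on 1) (\<lambda>_. X) = ?e ` X"
    by (rule level_product_natLeq_on_1)
  then have "c ` level_product \<kappa> (natLeq_on 1) (\<lambda>_. X) = {j}"
    using \<open>X \<noteq> {}\<close> unfolding X_def by auto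
  then have "card (c ` level_product \<kappa> (natLeq_on 1) (\<lambda>_. X)) = 1" by simp
  moreover have "\<forall>i\<in>Field (natLeq_on 1). t \<in> level \<kappa> (T i) \<zeta> \<and> X \<subseteq> level \<kappa> (T i) \<zeta>' \<and>
      dominates X (level \<kappa> (T i) (ord_succ \<kappa> \<zeta>) \<inter> Cone \<kappa> t)"
    using t dom by (subst Field_natLeq_on) (auto simp: X_def)
  ultimately show "\<exists>\<zeta>'\<in>Field \<kappa>. \<exists>\<zeta>\<in>underS \<kappa> \<zeta>'. \<exists>t X.
        (\<forall>i\<in>Field (natLeq_on 1).
          t i \<in> level \<kappa> (T i) \<zeta> \<and>
          X i \<subseteq> level \<kappa> (T i) \<zeta>' \<and>
          dominates (X i) (level \<kappa> (T i) (ord_succ \<kappa> \<zeta>) \<inter> Cone \<kappa> (t i))) \<and>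
        card (c ` level_product \<kappa> (natLeq_on 1) X) = 1"
    using F(2) \<zeta>
    by (intro bexI[of _ \<zeta>'] bexI[of _ \<zeta>] exI[of _ "\<lambda>_. t"] exI[of _ "\<lambda>_. X"] conjI) auto
qed

end
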